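(* Let $n$ be an odd positive integer with prime factorization $n=p_1^{\ell_1}\cdots p_r^{\ell_r}$ (distinct odd primes $p_q$, exponents $\ell_q\ge 1$). Let $k\ge 1$ and let $a_1,\dots,a_k,b$ be integers. Let $S_n(b;a_1,\dots,a_k)$ denote the number of $k$-tuples $(x_1,\dots,x_k)\in(\mathbb{Z}/n\mathbb{Z})^k$ such that every $x_i$ is a square modulo $n$ (i.e. $y^2\equiv x_i \pmod n$ is solvable) and $a_1x_1+\dots+a_kx_k\equiv b \pmod n$. Then $$S_n(b;a_1,\dots,a_k)=\frac{1}{n}\prod_{q=1}^{r}\Bigg(\sum_{m=1}^{p_q^{\ell_q}} e\Big(\frac{-bm}{p_q^{\ell_q}}\Big)+\sum_{\substack{K\subseteq\{1,\dots,k\}\\ K\neq\emptyset}}\frac{1}{2^{|K|}}\,S_{K,q}\Bigg),$$ where $$S_{K,q}=\sum_{m=1}^{p_q^{\ell_q}} e\Big(\frac{-bm}{p_q^{\ell_q}}\Big)\prod_{i\in K}\Bigg(\sum_{\substack{j=0\\ j\equiv 0 \ (\mathrm{mod}\ 2)}}^{\ell_q-1}\Big(C_{p_q^{\ell_q-j}}(a_im)+\varepsilon_{p_q}\Big(\frac{a_im/p_q^{\ell_q-j-1}}{p_q}\Big)\varrho_{q,j}(a_im)\,p_q^{\ell_q-j-\frac12}\Big)\Bigg),$$ and $\varrho_{q,j}(x)=1$ if $\gcd(x,p_q^{\ell_q-j})=p_q^{\ell_q-j-1}$ and $\varrho_{q,j}(x)=0$ otherwise (the term containing the Legendre symbol is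 taken to be $0$ when $\varrho_{q,j}(a_im)=0$).
   Context: $e(x)=e^{2\pi i x}$. For a positive integer $N$ and integer $c$, $C_N(c)=\sum_{1\le j\le N,\ \gcd(j,N)=1} e(jc/N)$ is the Ramanujan sum. $\big(\frac{\cdot}{p}\big)$ is the Legendre symbol modulo the odd prime $p$. For an odd prime $p$, $\varepsilon_p=1$ if $p\equiv 1\pmod 4$ and $\varepsilon_p=i$ if $p\equiv 3 \pmod 4$. *)

theory Defs
  imports Complex_Main "HOL-Library.FuncSet" "HOL-Number_Theory.Number_Theory"
begin

definition e_fun :: "real \<Rightarrow> complex" where
  "e_fun x = exp (2 * complex_of_real pi * \<i> * complex_of_real x)"

definition Ramanujan_sum :: "nat \<Rightarrow> int \<Rightarrow> complex" where
  "Ramanujan_sum N c =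
     (\<Sum>j | j \<in> {1..N} \<and> gcd j N = 1. e_fun (real j * real_of_int c / real N))"

definition eps :: "nat \<Rightarrow> complex" where
  "eps p = (if [p = 1] (mod 4) then 1 else \<i>)"

text \<open>\<open>rho p l j x\<close> is \<open>\<varrho>\<^bsub>q,j\<^esub>(x)\<close> for the prime power \<open>p ^ l\<close>, with \<open>j < l\<close>.\<close>

definition rho :: "nat \<Rightarrow> nat \<Rightarrow> nat \<Rightarrow> int \<Rightarrow> complex" where
  "rho p l j x = (if gcd x (int p ^ (l - j)) = int p ^ (l - j - 1) then 1 else 0)"

text \<open>
  The integer division below is exact whenever \<open>rho p l j (a i * m) \<noteq> 0\<close>; otherwise
  the factor \<open>rho\<close> makes the whole term with the Legendre symbol vanish.
\<close>

definition S_sub :: "nat \<Rightarrow> nat \<Rightarrow> int \<Rightarrow> (nat \<Rightarrow> int) \<Rightarrow> nat set \<Rightarrow> complex" where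
  "S_sub p l b a K =
     (\<Sum>m = 1..p ^ l. e_fun (- real_of_int b * real m / real (p ^ l)) *
        (\<Prod>i\<in>K. \<Sum>j | j \<in> {0..l - 1} \<and> [j = 0] (mod 2).
           Ramanujan_sum (p ^ (l - j)) (a i * int m)
           + eps p * of_int (Legendre (a i * int m div int p ^ (l - j - 1)) (int p))
             * rho p l j (a i * int m)
             * complex_of_real (real p powr (real l - real j - 1 / 2))))"

text \<open>\<open>\<int>/n\<int>\<close> is represented by the residues \<open>{0..<n}\<close>, and \<open>k\<close>-tuples by
  extensional functions on \<open>{1..k}\<close>.\<close>

definition S_count :: "nat \<Rightarrow> nat \<Rightarrow> int \<Rightarrow> (nat \<Rightarrow> int) \<Rightarrow> nat" where
  "S_count n k b a =
     card {x \<in> {1..k} \<rightarrow>\<^sub>E {0..<int n}.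
             (\<forall>i\<in>{1..k}. QuadRes (int n) (x i)) \<and>
             [(\<Sum>i = 1..k. a i * x i) = b] (mod int n)}"

end

theory Submission
  imports Defs
begin

text \<open>
  By the Chinese remainder theorem both sides are multiplicative, so \<open>n = p\<^sup>l\<close> may be assumed.
  Orthogonality of additive characters expresses the count as \<open>1/n\<close> times a sum over \<open>m\<close>
  of \<open>e(-bm/n)\<close> times the product over \<open>i\<close> of the sums of \<open>e(a\<^sub>i m x / n)\<close> over the squares
  \<open>x\<close> modulo \<open>n\<close>. The nonzero squares are the \<open>p\<^sup>j u\<close> with \<open>j < l\<close> even and \<open>u\<close> a unit that is a
  quadratic residue modulo \<open>p\<close>, and \<open>(1 + (u/p))/2\<close> detects these \<open>u\<close>: the \<open>1\<close> yields
  a Ramanujan sum and \<open>(u/p)\<close> a Gauss sum. Expanding the product over \<open>i\<close> gives the sum over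
  the sets \<open>K\<close>.

  The value of the quadratic Gauss sum, including its sign, follows Gauss: the alternating sum
  of \<open>q\<close>-binomial coefficients factors as \<open>(1 - q)(1 - q\<^sup>3)(1 - q\<^sup>5)\<dots>\<close>, and at a root of
  unity this factorization writes the Gauss sum as an explicit product of sines, whose sign
  can be read off.
\<close>

section \<open>Additive characters modulo \<open>N\<close>\<close>

definition e_mod :: "nat \<Rightarrow> int \<Rightarrow> complex" where
  "e_mod N c = e_fun (real_of_int c / real N)"

lemma e_mod_add: "e_mod N (c + d) = e_mod N c * e_mod N d"
  by (simp add: e_mod_def e_fun_def add_divide_distrib distrib_left exp_add)

lemma e_mod_0 [simp]: "e_mod N 0 = 1"
  by (simp add: e_mod_def e_fun_def)

lemma e_mod_eq_cis: "e_mod N c = cis (2 * pi * real_of_int c / real N)"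
  by (simp add: e_mod_def e_fun_def cis_conv_exp mult_ac)

lemma cnj_e_mod: "cnj (e_mod N c) = e_mod N (- c)"
  by (simp add: e_mod_eq_cis cis_cnj)

lemma e_mod_power: "e_mod N c ^ k = e_mod N (int k * c)"
  by (induction k) (simp_all add: e_mod_add distrib_right)

lemma e_mod_prod: "(\<Prod>i\<in>A. e_mod N (f i)) = e_mod N (\<Sum>i\<in>A. f i)"
  by (induction A rule: infinite_finite_induct) (simp_all add: e_mod_add)

lemma e_mod_eq_1_iff:
  assumes "N > 0"
  shows "e_mod N c = 1 \<longleftrightarrow> int N dvd c"
proof -
  have "e_mod N c = 1 \<longleftrightarrow> cos (2 * pi * real_of_int c / real N) = 1"
    by (auto simp: e_mod_eq_cis complex_eq_iff cos_one_sin_zero)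
  also have "\<dots> \<longleftrightarrow> (\<exists>n::int. 2 * pi * real_of_int c / real N = of_int n * 2 * pi)"
    by (rule cos_one_2pi_int)
  also have "\<dots> \<longleftrightarrow> (\<exists>n::int. real_of_int c = real_of_int (int N * n))"
    using assms by (intro ex_cong1) (auto simp: field_simps)
  finally show ?thesis
    by (simp only: of_int_eq_iff dvd_def)
qed

lemma e_mod_cong:
  assumes "N > 0" "[c = d] (mod int N)"
  shows "e_mod N c = e_mod N d"
proof -
  have "e_mod N (c - d) = 1"
    using assms by (simp add: e_mod_eq_1_iff cong_iff_dvd_diff)
  then show ?thesis
    using e_mod_add[of N "c - d" d] by simp
qed

lemma e_mod_cancel_left:
  assumes "M > 0"
  shows "e_mod (M * N) (int M * c) = e_mod N c"
  using assms by (simp add: e_mod_def)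

lemma sum_residues_reindex:
  fixes f :: "int \<Rightarrow> 'a::comm_monoid_add" and N :: int
  assumes "N > 0"
    and f: "\<And>x y. [x = y] (mod N) \<Longrightarrow> f x = f y"
    and h: "\<And>x y. [h x = h y] (mod N) \<Longrightarrow> [x = y] (mod N)"
  shows "(\<Sum>x\<in>{0..<N}. f (h x)) = (\<Sum>x\<in>{0..<N}. f x)"
proof -
  have inj: "inj_on (\<lambda>x. h x mod N) {0..<N}"
  proof (rule inj_onI)
    fix x y assume xy: "x \<in> {0..<N}" "y \<in> {0..<N}" "h x mod N = h y mod N"
    then have "[x = y] (mod N)"
      using h[of x y] by (simp add: cong_def)
    with xy show "x = y"
      by (simp add: cong_def)
  qed
  have "(\<lambda>x. h x mod N) ` {0..<N} = {0..<N}"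
    using inj \<open>N > 0\<close> by (intro endo_inj_surj) auto
  then have "(\<Sum>x\<in>{0..<N}. f x) = (\<Sum>x\<in>{0..<N}. f (h x mod N))"
    using sum.reindex[OF inj, of f] by simp
  also have "\<dots> = (\<Sum>x\<in>{0..<N}. f (h x))"
    by (rule sum.cong[OF refl], rule f) simp
  finally show ?thesis ..
qed

lemma sum_residues_atLeastAtMost:
  fixes f :: "int \<Rightarrow> 'a::comm_monoid_add"
  assumes "N > 0" and f: "\<And>x y. [x = y] (mod int N) \<Longrightarrow> f x = f y"
  shows "(\<Sum>m = 1..N. f (int m)) = (\<Sum>x\<in>{0..<int N}. f x)"
proof -
  have "(\<Sum>x\<in>{0..<int N}. f x) = (\<Sum>x\<in>{0..<int N}. f (x + 1))"
    by (rule sum_residues_reindex[symmetric])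
      (use assms in \<open>auto simp: cong_add_rcancel\<close>)
  also have "\<dots> = (\<Sum>m = 1..N. f (int m))"
    by (rule sum.reindex_bij_witness[of _ "\<lambda>m. int m - 1" "\<lambda>x. nat (x + 1)"]) auto
  finally show ?thesis ..
qed

lemma sum_residues_lessThan:
  fixes f :: "int \<Rightarrow> 'a::comm_monoid_add"
  shows "(\<Sum>j<N. f (int j)) = (\<Sum>x\<in>{0..<int N}. f x)"
  by (rule sum.reindex_bij_witness[of _ nat int]) auto

lemma e_mod_orthogonality:
  assumes "N > 0"
  shows "(\<Sum>x\<in>{0..<int N}. e_mod N (c * x)) = (if int N dvd c then of_nat N else 0)"
proof (cases "int N dvd c")
  case True
  then have "e_mod N (c * x) = 1" for x
    using assms by (simp add: e_mod_eq_1_iff)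
  with True show ?thesis by simp
next
  case False
  let ?S = "\<Sum>x\<in>{0..<int N}. e_mod N (c * x)"
  have "?S = (\<Sum>x\<in>{0..<int N}. e_mod N (c * (x + 1)))"
    by (rule sum_residues_reindex[symmetric])
      (use assms in \<open>auto simp: cong_add_rcancel intro: e_mod_cong cong_scalar_left\<close>)
  also have "\<dots> = e_mod N c * ?S"
    by (simp add: sum_distrib_left distrib_left e_mod_add mult_ac)
  finally have "(1 - e_mod N c) * ?S = 0"
    by (simp add: algebra_simps)
  then show ?thesis
    using False assms by (auto simp: e_mod_eq_1_iff)
qed

section \<open>The quadratic Gauss sum\<close>

fun gauss_binomial :: "'a::comm_ring_1 \<Rightarrow> nat \<Rightarrow> nat \<Rightarrow> 'a" where
  "gauss_binomial q m 0 = 1"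
| "gauss_binomial q 0 (Suc j) = 0"
| "gauss_binomial q (Suc m) (Suc j) =
     gauss_binomial q m j + q ^ Suc j * gauss_binomial q m (Suc j)"

lemma gauss_binomial_eq_0: "m < j \<Longrightarrow> gauss_binomial q m j = 0"
  by (induction q m j rule: gauss_binomial.induct) auto

lemma gauss_binomial_absorption_if_step:
  assumes step: "(1 - q ^ Suc j) * gauss_binomial q m (Suc j)
      = (1 - q ^ (m - j)) * gauss_binomial q m j"
  shows "(1 - q ^ Suc j) * gauss_binomial q (Suc m) (Suc j)
      = (1 - q ^ Suc m) * gauss_binomial q m j"
proof (cases "j \<le> m")
  case True
  have pow: "q ^ Suc j * q ^ (m - j) = q ^ Suc m"
    unfolding power_add[symmetric] using True by (intro arg_cong[of _ _ "(^) q"]) simp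
  have "(1 - q ^ Suc j) * gauss_binomial q (Suc m) (Suc j)
      = (1 - q ^ Suc j) * gauss_binomial q m j
        + q ^ Suc j * ((1 - q ^ Suc j) * gauss_binomial q m (Suc j))"
    by (simp add: algebra_simps)
  also have "\<dots> = (1 - q ^ Suc j + q ^ Suc j * (1 - q ^ (m - j))) * gauss_binomial q m j"
    unfolding step by (simp add: algebra_simps)
  also have "\<dots> = (1 - q ^ Suc m) * gauss_binomial q m j"
    by (simp add: right_diff_distrib pow del: power_Suc)
  finally show ?thesis .
qed (simp add: gauss_binomial_eq_0)

lemma gauss_binomial_step:
  "(1 - q ^ Suc j) * gauss_binomial q m (Suc j) = (1 - q ^ (m - j)) * gauss_binomial q m j"
proof (induction m arbitrary: j)
  case 0
  then show ?case by (cases j) auto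
next
  case (Suc m)
  show ?case
  proof (cases "j \<le> m")
    case False
    then show ?thesis
      by (cases "j = Suc m") (simp_all add: gauss_binomial_eq_0)
  next
    case True
    have *: "(1 - q ^ Suc j) * gauss_binomial q (Suc m) (Suc j)
        = (1 - q ^ Suc m) * gauss_binomial q m j"
      using Suc.IH by (rule gauss_binomial_absorption_if_step)
    show ?thesis
    proof (cases j)
      case 0
      then show ?thesis using * by simp
    next
      case (Suc i)
      have pow': "q ^ j * q ^ (Suc m - j) = q ^ Suc m"
        using True by (simp flip: power_add)
      have "(1 - q ^ (Suc m - j)) * gauss_binomial q (Suc m) j
          = (1 - q ^ (m - i)) * gauss_binomial q m i
            + (1 - q ^ (Suc m - j)) * q ^ j * gauss_binomial q m j"
        using Suc by (simp add: algebra_simps)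
      also have "\<dots> = (1 - q ^ j + (1 - q ^ (Suc m - j)) * q ^ j) * gauss_binomial q m j"
        unfolding Suc.IH[of i, symmetric] using Suc by (simp add: algebra_simps)
      also have "\<dots> = (1 - q ^ Suc m) * gauss_binomial q m j"
        using pow' by (simp add: algebra_simps del: power_Suc)
      finally show ?thesis using * by simp
    qed
  qed
qed

lemma gauss_binomial_absorption:
  "(1 - q ^ Suc j) * gauss_binomial q (Suc m) (Suc j) = (1 - q ^ Suc m) * gauss_binomial q m j"
  using gauss_binomial_step by (rule gauss_binomial_absorption_if_step)

lemma gauss_binomial_alternating_step:
  "(\<Sum>j\<le>Suc (Suc m). (- 1) ^ j * gauss_binomial q (Suc (Suc m)) j) =
   (1 - q ^ Suc m) * (\<Sum>j\<le>m. (- 1) ^ j * gauss_binomial q m j)"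
proof -
  let ?g = "\<lambda>j. gauss_binomial q (Suc m) j"
  have "(\<Sum>j\<le>Suc (Suc m). (- 1) ^ j * gauss_binomial q (Suc (Suc m)) j)
      = 1 + (\<Sum>j\<le>Suc m. (- 1) ^ Suc j * (?g j + q ^ Suc j * ?g (Suc j)))"
    by (subst sum.atMost_Suc_shift) simp
  also have "\<dots> = 1 + (\<Sum>j\<le>Suc m. (- 1) ^ Suc j * q ^ Suc j * ?g (Suc j))
      - (\<Sum>j\<le>Suc m. (- 1) ^ j * ?g j)"
    unfolding add_diff_eq[symmetric] sum_subtractf[symmetric]
    by (intro arg_cong[of _ _ "(+) 1"] sum.cong)
      (simp_all add: algebra_simps del: gauss_binomial.simps)
  also have "1 + (\<Sum>j\<le>Suc m. (- 1) ^ Suc j * q ^ Suc j * ?g (Suc j))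
      = (\<Sum>j\<le>Suc (Suc m). (- 1) ^ j * q ^ j * ?g j)"
    by (subst (2) sum.atMost_Suc_shift) simp
  also have "\<dots> = (\<Sum>j\<le>Suc m. (- 1) ^ j * q ^ j * ?g j)"
    by (simp add: gauss_binomial_eq_0 del: gauss_binomial.simps)
  also have "\<dots> - (\<Sum>j\<le>Suc m. (- 1) ^ j * ?g j) = (\<Sum>j\<le>Suc m. - ((- 1) ^ j * ((1 - q ^ j) * ?g j)))"
    unfolding sum_subtractf[symmetric] by (rule sum.cong) (simp_all add: algebra_simps)
  also have "\<dots> = (\<Sum>j\<le>m. - ((- 1) ^ Suc j * ((1 - q ^ Suc j) * ?g (Suc j))))"
    by (subst sum.atMost_Suc_shift) simp
  also have "\<dots> = (1 - q ^ Suc m) * (\<Sum>j\<le>m. (- 1) ^ j * gauss_binomial q m j)"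
    unfolding gauss_binomial_absorption sum_distrib_left
    by (rule sum.cong) (simp_all add: algebra_simps)
  finally show ?thesis .
qed

lemma gauss_binomial_alternating_sum:
  "(\<Sum>j\<le>2 * t. (- 1) ^ j * gauss_binomial q (2 * t) j) = (\<Prod>i<t. 1 - q ^ (2 * i + 1))"
proof (induction t)
  case (Suc t)
  have "2 * Suc t = Suc (Suc (2 * t))" by simp
  then show ?case
    by (simp only: gauss_binomial_alternating_step Suc.IH prod.lessThan_Suc)
      (simp add: mult.commute)
qed simp

lemma gauss_binomial_root_of_unity:
  fixes q :: "'a::field"
  assumes "q ^ N = 1" "\<And>i. 0 < i \<Longrightarrow> i < N \<Longrightarrow> q ^ i \<noteq> 1" "j < N"
  shows "q ^ (j * (j + 1) div 2) * gauss_binomial q (N - 1) j = (- 1) ^ j"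
  using \<open>j < N\<close>
proof (induction j)
  case (Suc j)
  let ?g = "gauss_binomial q (N - 1)"
  have pow: "q ^ Suc j * q ^ (N - 1 - j) = 1"
    unfolding power_add[symmetric] using Suc.prems assms(1) by simp
  have ne: "1 - q ^ Suc j \<noteq> 0"
    using assms(2)[of "Suc j"] Suc.prems by auto
  have "(1 - q ^ Suc j) * (q ^ Suc j * ?g (Suc j)) = (q ^ Suc j * (1 - q ^ (N - 1 - j))) * ?g j"
    using gauss_binomial_step[of q j "N - 1"] by (simp only: mult_ac)
  also have "\<dots> = (1 - q ^ Suc j) * (- ?g j)"
    by (simp only: right_diff_distrib pow) (simp add: algebra_simps)
  finally have *: "q ^ Suc j * ?g (Suc j) = - ?g j"
    using ne by (simp only: mult_cancel_left) simp
  have "Suc j * (Suc j + 1) div 2 = j * (j + 1) div 2 + Suc j"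
    by simp
  then have "q ^ (Suc j * (Suc j + 1) div 2) * ?g (Suc j)
      = q ^ (j * (j + 1) div 2) * (q ^ Suc j * ?g (Suc j))"
    by (simp only: power_add mult.assoc)
  also have "\<dots> = (- 1) ^ Suc j"
    unfolding * using Suc by simp
  finally show ?case .
qed simp

lemma sum_odd_eq_square: "(\<Sum>i<m. 2 * int i + 1) = int m ^ 2"
  by (induction m) (simp_all add: power2_eq_square algebra_simps)

text \<open>
  The alternating sum is taken at \<open>q = \<zeta>\<^sup>-\<^sup>2\<close>, where \<open>\<zeta> = e(1/N)\<close>: its summands become
  \<open>\<zeta>\<^bsup>j(j+1)\<^esup>\<close>, and completing the square turns it into the Gauss sum.
\<close>

lemma gauss_sum_eq_prod_sin:
  assumes N: "N = 2 * m + 1"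
  shows "(\<Sum>x\<in>{0..<int N}. e_mod N (x\<^sup>2)) =
    (\<Prod>i<m. 2 * \<i> * complex_of_real (sin (2 * pi * (2 * real i + 1) / real N)))"
proof -
  have pos: "N > 0" and oddN: "odd (int N)" using N by auto
  define q where "q = e_mod N (- 2)"
  have qpow: "q ^ i = e_mod N (- 2 * int i)" for i
    by (simp add: q_def e_mod_power mult.commute)
  have q1: "q ^ N = 1"
    using pos by (simp add: qpow e_mod_eq_1_iff)
  have q2: "q ^ i \<noteq> 1" if "0 < i" "i < N" for i
  proof
    assume "q ^ i = 1"
    then have "int N dvd 2 * int i"
      using pos by (simp add: qpow e_mod_eq_1_iff)
    then have "int N dvd int i"
      using oddN by (simp add: coprime_dvd_mult_right_iff coprime_commute)
    then show False
      using that by (simp add: nat_dvd_not_less)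
  qed
  have e_mod_term: "e_mod N (int j * (int j + 1))
      = (- 1) ^ j * gauss_binomial q (2 * m) j" if "j < N" for j
  proof -
    have "int (j * (j + 1) div 2) * 2 = int j * (int j + 1)"
    proof -
      have "j * (j + 1) div 2 * 2 = j * (j + 1)"
        by (rule dvd_div_mult_self) simp
      from arg_cong[OF this, of int] show ?thesis
        by (simp only: of_nat_mult of_nat_numeral of_nat_add of_nat_1)
    qed
    then have "q ^ (j * (j + 1) div 2) = e_mod N (- (int j * (int j + 1)))"
      by (simp add: qpow mult.commute)
    then have "e_mod N (- (int j * (int j + 1))) * gauss_binomial q (2 * m) j = (- 1) ^ j"
      using gauss_binomial_root_of_unity[OF q1 q2 that] N by simp
    then have "e_mod N (int j * (int j + 1)) * (e_mod N (- (int j * (int j + 1)))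
        * gauss_binomial q (2 * m) j)
        = e_mod N (int j * (int j + 1)) * (- 1) ^ j" by simp
    then have "gauss_binomial q (2 * m) j = e_mod N (int j * (int j + 1)) * (- 1) ^ j"
      by (simp flip: mult.assoc e_mod_add)
    then show ?thesis by simp
  qed
  have "(\<Sum>x\<in>{0..<int N}. e_mod N (x\<^sup>2)) = (\<Sum>x\<in>{0..<int N}. e_mod N ((x + (int m + 1))\<^sup>2))"
    by (rule sum_residues_reindex[symmetric])
      (use pos in \<open>auto simp: cong_add_rcancel intro: e_mod_cong cong_pow\<close>)
  also have "\<dots> = (\<Sum>x\<in>{0..<int N}. e_mod N ((int m + 1)\<^sup>2) * e_mod N (x * (x + 1)))"
  proof (rule sum.cong)
    fix x :: int
    have "(x + (int m + 1))\<^sup>2 = (int m + 1)\<^sup>2 + x * (x + 1) + int N * x"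
      using N by (simp add: power2_eq_square algebra_simps)
    then have "e_mod N ((x + (int m + 1))\<^sup>2) = e_mod N ((int m + 1)\<^sup>2 + x * (x + 1))"
      using pos by (intro e_mod_cong) (simp_all add: cong_iff_dvd_diff)
    then show "e_mod N ((x + (int m + 1))\<^sup>2) = e_mod N ((int m + 1)\<^sup>2) * e_mod N (x * (x + 1))"
      by (simp add: e_mod_add)
  qed simp
  also have "\<dots> = e_mod N ((int m + 1)\<^sup>2) * (\<Sum>j<N. e_mod N (int j * (int j + 1)))"
    by (simp add: sum_distrib_left sum_residues_lessThan[of "\<lambda>x. e_mod N (x * (x + 1))"])
  also have "(\<Sum>j<N. e_mod N (int j * (int j + 1)))
      = (\<Sum>j\<le>2 * m. (- 1) ^ j * gauss_binomial q (2 * m) j)"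
    by (rule sum.cong) (use N e_mod_term in auto)
  also have "\<dots> = (\<Prod>i<m. 1 - q ^ (2 * i + 1))"
    by (rule gauss_binomial_alternating_sum)
  also have "\<dots> = (\<Prod>i<m. e_mod N (- (2 * int i + 1)) *
      (2 * \<i> * complex_of_real (sin (2 * pi * (2 * real i + 1) / real N))))"
  proof (rule prod.cong)
    fix i
    let ?k = "2 * int i + 1"
    have "1 - q ^ (2 * i + 1) = e_mod N (- ?k) * (e_mod N ?k - e_mod N (- ?k))"
      unfolding qpow right_diff_distrib e_mod_add[symmetric] by (simp add: algebra_simps)
    also have "e_mod N ?k - e_mod N (- ?k)
        = 2 * \<i> * complex_of_real (sin (2 * pi * (2 * real i + 1) / real N))"
      unfolding cnj_e_mod[symmetric] by (simp add: e_mod_eq_cis complex_eq_iff)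
    finally show "1 - q ^ (2 * i + 1) = e_mod N (- ?k) *
      (2 * \<i> * complex_of_real (sin (2 * pi * (2 * real i + 1) / real N)))" .
  qed simp
  also have "\<dots> = e_mod N (- (int m)\<^sup>2) *
      (\<Prod>i<m. 2 * \<i> * complex_of_real (sin (2 * pi * (2 * real i + 1) / real N)))"
    by (simp add: prod.distrib e_mod_prod sum_negf sum_odd_eq_square[symmetric]
        del: minus_add_distrib)
  also have "e_mod N ((int m + 1)\<^sup>2) * \<dots> = e_mod N ((int m + 1)\<^sup>2 - (int m)\<^sup>2) *
      (\<Prod>i<m. 2 * \<i> * complex_of_real (sin (2 * pi * (2 * real i + 1) / real N)))"
    by (simp add: e_mod_add[of _ _ "- _", simplified])
  also have "(int m + 1)\<^sup>2 - (int m)\<^sup>2 = int N"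
    using N by (simp add: power2_eq_square algebra_simps)
  also have "e_mod N (int N) = 1"
    using pos by (simp add: e_mod_eq_1_iff)
  finally show ?thesis by simp
qed

lemma norm_gauss_sum:
  assumes "odd N"
  shows "norm (\<Sum>x\<in>{0..<int N}. e_mod N (x\<^sup>2)) = sqrt (real N)"
proof -
  let ?R = "{0..<int N}"
  define g where "g = (\<Sum>x\<in>?R. e_mod N (x\<^sup>2))"
  have pos: "N > 0" using assms by (auto intro: Nat.gr0I)
  have "g * cnj g = (\<Sum>y\<in>?R. (\<Sum>x\<in>?R. e_mod N (x\<^sup>2)) * e_mod N (- (y\<^sup>2)))"
    by (simp add: g_def cnj_e_mod sum_distrib_left)
  also have "\<dots> = (\<Sum>y\<in>?R. \<Sum>x\<in>?R. e_mod N ((x + y)\<^sup>2) * e_mod N (- (y\<^sup>2)))"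
  proof (rule sum.cong)
    fix y
    have "(\<Sum>x\<in>?R. e_mod N (x\<^sup>2)) = (\<Sum>x\<in>?R. e_mod N ((x + y)\<^sup>2))"
      by (rule sum_residues_reindex[symmetric])
        (use pos in \<open>auto simp: cong_add_rcancel intro: e_mod_cong cong_pow\<close>)
    then show "(\<Sum>x\<in>?R. e_mod N (x\<^sup>2)) * e_mod N (- (y\<^sup>2))
        = (\<Sum>x\<in>?R. e_mod N ((x + y)\<^sup>2) * e_mod N (- (y\<^sup>2)))"
      by (simp add: sum_distrib_right)
  qed simp
  also have "\<dots> = (\<Sum>y\<in>?R. \<Sum>x\<in>?R. e_mod N (x\<^sup>2) * e_mod N ((2 * x) * y))"
    by (simp add: power2_eq_square algebra_simps flip: e_mod_add)
  also have "\<dots> = (\<Sum>x\<in>?R. e_mod N (x\<^sup>2) * (\<Sum>y\<in>?R. e_mod N ((2 * x) * y)))"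
    by (subst sum.swap) (simp only: sum_distrib_left)
  also have "\<dots> = (\<Sum>x\<in>?R. if x = 0 then of_nat N else 0)"
  proof (rule sum.cong)
    fix x assume x: "x \<in> ?R"
    have "int N dvd 2 * x \<longleftrightarrow> int N dvd x"
      using assms by (simp add: coprime_dvd_mult_right_iff coprime_commute)
    also have "\<dots> \<longleftrightarrow> x = 0"
      using x by (auto dest: zdvd_imp_le)
    finally show "e_mod N (x\<^sup>2) * (\<Sum>y\<in>?R. e_mod N ((2 * x) * y)) = (if x = 0 then of_nat N else 0)"
      using e_mod_orthogonality[OF pos, of "2 * x"] by simp
  qed simp
  also have "\<dots> = of_nat N"
    using pos by simp
  finally have "complex_of_real ((norm g)\<^sup>2) = complex_of_real (real N)"
    unfolding complex_norm_square by simp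
  then have "(norm g)\<^sup>2 = real N"
    by (simp only: of_real_eq_iff)
  then show ?thesis
    unfolding g_def using real_sqrt_unique by fastforce
qed

lemma prod_sin_sign:
  fixes N m :: nat
  assumes N: "N = 2 * m + 1"
  defines "s \<equiv> \<lambda>i. sin (2 * pi * (2 * real i + 1) / real N)"
  shows "(\<Prod>i<m. s i) = (- 1) ^ (m div 2) * \<bar>\<Prod>i<m. s i\<bar>"
proof -
  let ?h = "(m + 1) div 2"
  have s: "s i = (if i < ?h then 1 else - 1) * \<bar>s i\<bar>" if "i < m" for i
  proof -
    let ?t = "2 * pi * (2 * real i + 1) / real N"
    have Npos: "real N > 0" using N by simp
    show ?thesis
    proof (cases "i < ?h")
      case True
      then have "2 * (2 * i + 1) \<le> N" using N by presburger
      then have "2 * (2 * real i + 1) \<le> real N"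
        by (simp flip: of_nat_le_iff[where 'a=real])
      then have "pi * (2 * (2 * real i + 1)) \<le> pi * real N"
        by (intro mult_left_mono) auto
      then have "?t \<le> pi" "0 \<le> ?t"
        using Npos by (simp_all add: field_simps)
      then have "s i \<ge> 0" unfolding s_def by (intro sin_ge_zero)
      with True show ?thesis by simp
    next
      case False
      then have "2 * (2 * i + 1) \<ge> N" "2 * i + 1 \<le> N" using N that by presburger+
      then have "2 * (2 * real i + 1) \<ge> real N" "2 * real i + 1 \<le> real N"
        by (simp_all flip: of_nat_le_iff[where 'a=real])
      then have "pi * real N \<le> pi * (2 * (2 * real i + 1))" "pi * (2 * real i + 1) \<le> pi * real N"
        by (auto intro!: mult_left_mono)
      then have t: "pi \<le> ?t" "?t \<le> 2 * pi"
        using Npos by (simp_all add: field_simps)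
      have "s i \<le> 0"
      proof (cases "?t = 2 * pi")
        case True
        then show ?thesis by (simp add: s_def)
      next
        case False
        then show ?thesis using t sin_le_zero[of ?t] by (simp add: s_def)
      qed
      with False show ?thesis by simp
    qed
  qed
  have "(\<Prod>i<m. s i) = (\<Prod>i<m. (if i < ?h then 1 else - 1) * \<bar>s i\<bar>)"
    by (rule prod.cong[OF refl]) (use s in simp)
  also have "\<dots> = (\<Prod>i<m. if i < ?h then 1 else - 1) * \<bar>\<Prod>i<m. s i\<bar>"
    by (simp only: prod.distrib abs_prod)
  also have "(\<Prod>i<m. if i < ?h then 1 else - 1 :: real) = (\<Prod>i\<in>{?h..<m}. - 1)"
    by (rule prod.mono_neutral_cong_right) auto
  also have "\<dots> = (- 1) ^ (m div 2)"
    by (simp, intro arg_cong[of _ _ "(^) (- 1)"]) linarith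
  finally show ?thesis .
qed

theorem gauss_sum_eq:
  assumes "odd N"
  shows "(\<Sum>x\<in>{0..<int N}. e_mod N (x\<^sup>2)) = eps N * complex_of_real (sqrt (real N))"
proof -
  obtain m where N: "N = 2 * m + 1" using assms by (elim oddE)
  define P where "P = (\<Prod>i<m. sin (2 * pi * (2 * real i + 1) / real N))"
  define g where "g = (\<Sum>x\<in>{0..<int N}. e_mod N (x\<^sup>2))"
  have "g = (2 * \<i>) ^ m * complex_of_real P"
    unfolding g_def P_def gauss_sum_eq_prod_sin[OF N] by (simp add: prod.distrib)
  also have "P = (- 1) ^ (m div 2) * \<bar>P\<bar>"
    unfolding P_def by (rule prod_sin_sign[OF N])
  finally have "g = (\<i> ^ m * (- 1) ^ (m div 2)) * complex_of_real (2 ^ m * \<bar>P\<bar>)"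
    by (simp add: power_mult_distrib mult_ac)
  also have "\<i> ^ m * (- 1) ^ (m div 2) = eps N"
  proof (cases "even m")
    case True
    then obtain t where "m = 2 * t" by (elim evenE)
    then show ?thesis
      using N by (simp add: eps_def cong_def power_mult flip: power_mult_distrib)
  next
    case False
    then obtain t where t: "m = 2 * t + 1" by (elim oddE)
    then have "N = 3 + t * 4" using N by simp
    then have "N mod 4 = 3" by simp
    then show ?thesis
      using t by (simp add: eps_def cong_def power_mult flip: power_mult_distrib)
  qed
  finally have g: "g = eps N * complex_of_real (2 ^ m * \<bar>P\<bar>)" .
  have "norm g = 2 ^ m * \<bar>P\<bar>"
    unfolding g norm_mult norm_of_real by (simp add: eps_def abs_mult)
  then have "2 ^ m * \<bar>P\<bar> = sqrt (real N)"
    using norm_gauss_sum[OF assms] by (simp add: g_def)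
  with g show ?thesis by (simp add: g_def)
qed

section \<open>Character sums over squares modulo a prime power\<close>

lemma cong_prime_square_iff:
  fixes x y p :: int
  assumes "prime p"
  shows "[x\<^sup>2 = y\<^sup>2] (mod p) \<longleftrightarrow> [x = y] (mod p) \<or> [x = - y] (mod p)"
proof -
  have "x\<^sup>2 - y\<^sup>2 = (x - y) * (x + y)"
    by (simp add: power2_eq_square algebra_simps)
  then show ?thesis
    using assms by (simp add: cong_iff_dvd_diff prime_dvd_mult_iff)
qed

lemma QuadRes_cong: "[a = b] (mod p) \<Longrightarrow> QuadRes p a \<longleftrightarrow> QuadRes p b"
  unfolding QuadRes_def by (meson cong_sym cong_trans)

lemma Legendre_cong: "[a = b] (mod p) \<Longrightarrow> Legendre a p = Legendre b p"
  unfolding Legendre_def using QuadRes_cong[of a b p] by (auto simp: cong_def)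

lemma Legendre_mult:
  assumes "prime p" "2 < p"
  shows "Legendre (a * b) (int p) = Legendre a (int p) * Legendre b (int p)"
proof -
  let ?L = "\<lambda>x. Legendre x (int p)"
  let ?h = "(p - 1) div 2"
  have "[?L (a * b) = (a * b) ^ ?h] (mod int p)"
    by (rule euler_criterion[OF assms])
  also have "(a * b) ^ ?h = a ^ ?h * b ^ ?h"
    by (rule power_mult_distrib)
  also have "[\<dots> = ?L a * ?L b] (mod int p)"
    by (intro cong_mult cong_sym[OF euler_criterion[OF assms]])
  finally have "int p dvd ?L (a * b) - ?L a * ?L b"
    by (simp add: cong_iff_dvd_diff)
  moreover have "\<bar>?L (a * b) - ?L a * ?L b\<bar> \<le> 2"
    by (simp add: Legendre_def)
  ultimately have "?L (a * b) - ?L a * ?L b = 0"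
    using assms(2) dvd_imp_le_int[of "?L (a * b) - ?L a * ?L b" "int p"] by fastforce
  then show ?thesis by simp
qed

lemma card_square_roots_mod_prime:
  assumes "prime p" "2 < p"
  shows "int (card {x \<in> {0..<int p}. [x\<^sup>2 = u] (mod int p)}) = 1 + Legendre u (int p)"
proof -
  let ?A = "{x \<in> {0..<int p}. [x\<^sup>2 = u] (mod int p)}"
  have p: "prime (int p)" using assms by simp
  consider "[u = 0] (mod int p)" | "\<not> [u = 0] (mod int p)" "\<not> QuadRes (int p) u"
    | y where "\<not> [u = 0] (mod int p)" "[y\<^sup>2 = u] (mod int p)"
    by (auto simp: QuadRes_def)
  then show ?thesis
  proof cases
    case 1
    then have "[x\<^sup>2 = u] (mod int p) \<longleftrightarrow> int p dvd x" for x
      using p by (metis cong_0_iff cong_sym cong_trans prime_dvd_power_iff zero_less_numeral)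
    then have "?A = {0}"
      using assms by (auto dest: zdvd_imp_le)
    then show ?thesis using 1 by (simp add: Legendre_def)
  next
    case 2
    then have "?A = {}" by (auto simp: QuadRes_def)
    with 2 show ?thesis by (simp only: Legendre_def) simp
  next
    case 3
    have ndvd: "\<not> int p dvd y"
    proof
      assume "int p dvd y"
      then have "[y\<^sup>2 = 0] (mod int p)"
        by (simp add: cong_0_iff power2_eq_square)
      with 3 show False
        by (meson cong_sym cong_trans)
    qed
    have "[x\<^sup>2 = u] (mod int p) \<longleftrightarrow> [x = y] (mod int p) \<or> [x = - y] (mod int p)" for x
      unfolding cong_prime_square_iff[OF p, symmetric] using 3 by (meson cong_sym cong_trans)
    moreover have "x \<in> {0..<int p} \<and> [x = z] (mod int p) \<longleftrightarrow> x = z mod int p" for x z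
      using assms(2) by (auto simp: cong_def)
    ultimately have "?A = {y mod int p, (- y) mod int p}"
      by blast
    moreover have "y mod int p \<noteq> (- y) mod int p"
    proof
      assume "y mod int p = (- y) mod int p"
      then have "int p dvd 2 * y"
        by (simp add: mod_eq_dvd_iff)
      then have "int p dvd 2"
        using ndvd p by (simp add: prime_dvd_mult_iff)
      then show False
        using assms by (auto dest: zdvd_imp_le)
    qed
    ultimately have "card ?A = 2" by simp
    moreover have "Legendre u (int p) = 1"
      using 3 by (auto simp: Legendre_def QuadRes_def)
    ultimately show ?thesis by simp
  qed
qed

lemma sum_squares_eq_sum_Legendre:
  assumes "prime p" "2 < p"
  shows "(\<Sum>x\<in>{0..<int p}. e_mod p (c * x\<^sup>2)) =
         (\<Sum>u\<in>{0..<int p}. (1 + of_int (Legendre u (int p))) * e_mod p (c * u))"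
proof -
  have pos: "p > 0" using assms by simp
  have "(\<Sum>x\<in>{0..<int p}. e_mod p (c * x\<^sup>2))
      = (\<Sum>u\<in>{0..<int p}. \<Sum>x\<in>{x\<in>{0..<int p}. x\<^sup>2 mod int p = u}. e_mod p (c * x\<^sup>2))"
    using pos by (intro sum.group[symmetric]) auto
  also have "\<dots> = (\<Sum>u\<in>{0..<int p}. (1 + of_int (Legendre u (int p))) * e_mod p (c * u))"
  proof (rule sum.cong)
    fix u assume u: "u \<in> {0..<int p}"
    then have set_eq: "{x\<in>{0..<int p}. x\<^sup>2 mod int p = u} = {x\<in>{0..<int p}. [x\<^sup>2 = u] (mod int p)}"
      by (auto simp: cong_def)
    have "(\<Sum>x\<in>{x\<in>{0..<int p}. x\<^sup>2 mod int p = u}. e_mod p (c * x\<^sup>2))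
        = (\<Sum>x\<in>{x\<in>{0..<int p}. [x\<^sup>2 = u] (mod int p)}. e_mod p (c * u))"
      unfolding set_eq by (rule sum.cong) (auto intro!: e_mod_cong cong_scalar_left pos)
    also have "\<dots> = of_int (int (card {x\<in>{0..<int p}. [x\<^sup>2 = u] (mod int p)})) * e_mod p (c * u)"
      by simp
    finally show "(\<Sum>x\<in>{x\<in>{0..<int p}. x\<^sup>2 mod int p = u}. e_mod p (c * x\<^sup>2))
        = (1 + of_int (Legendre u (int p))) * e_mod p (c * u)"
      unfolding card_square_roots_mod_prime[OF assms] by simp
  qed simp
  finally show ?thesis .
qed

lemma sum_Legendre_e_mod:
  assumes "prime p" "2 < p"
  shows "(\<Sum>u\<in>{0..<int p}. of_int (Legendre u (int p)) * e_mod p (c * u)) =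
         of_int (Legendre c (int p)) * eps p * complex_of_real (sqrt (real p))"
proof -
  have pos: "p > 0" using assms by simp
  have p: "prime (int p)" using assms by simp
  let ?R = "{0..<int p}"
  let ?L = "\<lambda>u. complex_of_int (Legendre u (int p))"
  have split: "(\<Sum>x\<in>?R. e_mod p (d * x\<^sup>2))
      = (\<Sum>u\<in>?R. e_mod p (d * u)) + (\<Sum>u\<in>?R. ?L u * e_mod p (d * u))" for d
    unfolding sum_squares_eq_sum_Legendre[OF assms] by (simp add: distrib_right sum.distrib)
  show ?thesis
  proof (cases "int p dvd c")
    case True
    then have 1: "e_mod p (c * x) = 1" for x
      using pos by (simp add: e_mod_eq_1_iff)
    have "(\<Sum>u\<in>?R. ?L u * e_mod p (c * u)) = 0"
      using split[of c] by (simp add: 1)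
    moreover have "Legendre c (int p) = 0"
      using True by (simp add: Legendre_def cong_0_iff)
    ultimately show ?thesis by simp
  next
    case False
    have LL: "?L c * ?L c = 1"
      using False by (auto simp: Legendre_def cong_0_iff)
    have cop: "coprime c (int p)"
      using False p by (metis coprime_commute prime_imp_coprime)
    have "(\<Sum>u\<in>?R. ?L u * e_mod p (c * u)) = ?L c * (\<Sum>u\<in>?R. ?L (c * u) * e_mod p (c * u))"
      using LL by (simp add: Legendre_mult[OF assms] sum_distrib_left flip: mult.assoc)
    also have "(\<Sum>u\<in>?R. ?L (c * u) * e_mod p (c * u)) = (\<Sum>u\<in>?R. ?L u * e_mod p u)"
      by (rule sum_residues_reindex[of "int p" "\<lambda>u. ?L u * e_mod p u" "\<lambda>u. c * u"])
        (use pos cop Legendre_cong e_mod_cong in \<open>auto simp: cong_mult_lcancel\<close>)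
    also have "\<dots> = (\<Sum>x\<in>?R. e_mod p (x\<^sup>2))"
      using split[of 1] e_mod_orthogonality[OF pos, of 1] assms by simp
    also have "\<dots> = eps p * complex_of_real (sqrt (real p))"
      using assms prime_odd_nat by (intro gauss_sum_eq) auto
    finally show ?thesis by simp
  qed
qed

lemma bij_betw_residues_mult:
  fixes M N :: int
  assumes "M > 0" "N > 0"
  shows "bij_betw (\<lambda>(u, v). u + M * v) ({0..<M} \<times> {0..<N}) {0..<M * N}"
proof (rule bij_betw_byWitness[where f' = "\<lambda>x. (x mod M, x div M)"])
  show "(\<lambda>(u, v). u + M * v) ` ({0..<M} \<times> {0..<N}) \<subseteq> {0..<M * N}"
  proof safe
    fix u v assume "u \<in> {0..<M}" "v \<in> {0..<N}"
    moreover from this have "M * v \<le> M * (N - 1)"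
      using assms by (intro mult_left_mono) auto
    ultimately show "u + M * v \<in> {0..<M * N}"
      using assms by (auto simp: algebra_simps)
  qed
  have "x div M < N" if "x < M * N" for x
  proof -
    have "M * (x div M) \<le> x"
      using assms mult_div_mod_eq[of M x] pos_mod_sign[of M x] by linarith
    then have "M * (x div M) < M * N" using that by linarith
    then show ?thesis using assms by simp
  qed
  then show "(\<lambda>x. (x mod M, x div M)) ` {0..<M * N} \<subseteq> {0..<M} \<times> {0..<N}"
    using assms by (auto simp: pos_imp_zdiv_nonneg_iff)
qed (use assms in auto)

lemma sum_Legendre_e_mod_prime_power:
  assumes "prime p" "2 < p"
  shows "(\<Sum>u\<in>{0..<int (p ^ Suc t)}. of_int (Legendre u (int p)) * e_mod (p ^ Suc t) (c * u)) =
    (if int p ^ t dvd c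
     then of_int (Legendre (c div int p ^ t) (int p)) * eps p * complex_of_real (sqrt (real p))
         * of_nat (p ^ t)
     else 0)"
proof -
  have pos: "p > 0" "p ^ t > 0" using assms by auto
  let ?L = "\<lambda>u. complex_of_int (Legendre u (int p))"
  have "(\<Sum>u\<in>{0..<int (p ^ Suc t)}. ?L u * e_mod (p ^ Suc t) (c * u))
      = (\<Sum>(u, v)\<in>{0..<int p} \<times> {0..<int (p ^ t)}. ?L (u + int p * v) * e_mod (p ^ Suc t) (c
          * (u + int p * v)))"
    using sum.reindex_bij_betw[OF bij_betw_residues_mult[of "int p" "int (p ^ t)"],
        of "\<lambda>u. ?L u * e_mod (p ^ Suc t) (c * u)"] pos
    by (simp add: case_prod_beta)
  also have "\<dots> = (\<Sum>(u, v)\<in>{0..<int p} \<times> {0..<int (p ^ t)}. ?L u * e_mod (p ^ Suc t) (c * u)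
      * e_mod (p ^ t) (c * v))"
  proof (rule sum.cong, simp, safe)
    fix u v
    have "Legendre (u + int p * v) (int p) = Legendre u (int p)"
      by (rule Legendre_cong) (simp add: cong_iff_dvd_diff)
    moreover have "e_mod (p ^ Suc t) (c * (u + int p * v))
        = e_mod (p ^ Suc t) (c * u) * e_mod (p ^ Suc t) (int p * (c * v))"
      by (simp add: e_mod_add distrib_left mult_ac)
    moreover have "e_mod (p ^ Suc t) (int p * (c * v)) = e_mod (p ^ t) (c * v)"
      using e_mod_cancel_left[OF pos(1), of "p ^ t" "c * v"] by simp
    ultimately show "?L (u + int p * v) * e_mod (p ^ Suc t) (c * (u + int p * v))
        = ?L u * e_mod (p ^ Suc t) (c * u) * e_mod (p ^ t) (c * v)"
      by simp
  qed
  also have "\<dots> = (\<Sum>u\<in>{0..<int p}. ?L u * e_mod (p ^ Suc t) (c * u))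
      * (\<Sum>v\<in>{0..<int (p ^ t)}. e_mod (p ^ t) (c * v))"
    by (simp only: sum_product sum.cartesian_product)
  also have "\<dots> = (if int p ^ t dvd c then (\<Sum>u\<in>{0..<int p}. ?L u * e_mod (p ^ Suc t) (c * u))
      * of_nat (p ^ t) else 0)"
    unfolding e_mod_orthogonality[OF pos(2)] by simp
  also have "\<dots> = (if int p ^ t dvd c
     then ?L (c div int p ^ t) * eps p * complex_of_real (sqrt (real p)) * of_nat (p ^ t)
     else 0)"
  proof (cases "int p ^ t dvd c")
    case True
    then obtain d where d: "c = int p ^ t * d" by (elim dvdE)
    have "e_mod (p ^ Suc t) (c * u) = e_mod p (d * u)" for u
      using e_mod_cancel_left[OF pos(2), of p "d * u"] d by (simp add: mult_ac)
    then show ?thesis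
      using d pos sum_Legendre_e_mod[OF assms, of d] by simp
  qed simp
  finally show ?thesis .
qed

lemma QuadRes_prime_power_iff:
  assumes "prime p" "2 < p" "\<not> int p dvd u"
  shows "QuadRes (int p ^ Suc t) u \<longleftrightarrow> QuadRes (int p) u"
proof
  assume "QuadRes (int p ^ Suc t) u"
  then show "QuadRes (int p) u"
    unfolding QuadRes_def by (metis cong_modulus_mult power_Suc)
next
  assume *: "QuadRes (int p) u"
  have p: "prime (int p)" using assms by simp
  show "QuadRes (int p ^ Suc t) u"
  proof (induction t)
    case 0
    show ?case using * by simp
  next
    case (Suc t)
    then obtain y where y: "[y\<^sup>2 = u] (mod int p ^ Suc t)"
      by (auto simp: QuadRes_def)
    then obtain s where s: "u - y\<^sup>2 = int p ^ Suc t * s"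
      by (metis cong_iff_dvd_diff cong_sym dvdE)
    have "\<not> int p dvd y"
    proof
      assume "int p dvd y"
      then have "int p dvd y\<^sup>2 + int p ^ Suc t * s"
        by (simp add: power2_eq_square)
      also have "y\<^sup>2 + int p ^ Suc t * s = u"
        unfolding s[symmetric] by simp
      finally show False using assms(3) by simp
    qed
    moreover have "\<not> int p dvd 2"
      using assms(2) by (auto dest: zdvd_imp_le)
    ultimately have "coprime (2 * y) (int p)"
      using p by (metis coprime_commute prime_dvd_mult_iff prime_imp_coprime)
    then obtain z where z: "[2 * y * z = 1] (mod int p)"
      using cong_solve_coprime_int by blast
    then have "[2 * y * (z * s) = s] (mod int p)"
      using cong_scalar_right[OF z, of s] by (simp add: mult.assoc)
    then obtain w where w: "2 * y * (z * s) - s = int p * w"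
      by (auto simp: cong_iff_dvd_diff)
    have "(y + int p ^ Suc t * (z * s))\<^sup>2 - u
        = int p ^ Suc t * (2 * y * (z * s) - s) + (int p ^ Suc t) * (int p ^ Suc t) * (z * s)\<^sup>2"
      using s by (simp add: power2_eq_square algebra_simps)
    also have "\<dots> = int p ^ Suc (Suc t) * (w + int p ^ t * (z * s)\<^sup>2)"
      unfolding w by (simp add: algebra_simps)
    finally have "[(y + int p ^ Suc t * (z * s))\<^sup>2 = u] (mod int p ^ Suc (Suc t))"
      by (simp add: cong_iff_dvd_diff)
    then show ?case by (auto simp: QuadRes_def)
  qed
qed

lemma QuadRes_prime_power_mult_iff:
  assumes "prime p" "2 < p" "\<not> int p dvd u" "j < l"
  shows "QuadRes (int p ^ l) (int p ^ j * u) \<longleftrightarrow> even j \<and> QuadRes (int p) u"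
proof
  have p: "prime (int p)" using assms by simp
  have l: "int p ^ l = int p ^ j * int p ^ (l - j)" "l - j = Suc (l - j - 1)"
    using assms(4) by (simp_all flip: power_add)
  {
    assume "QuadRes (int p ^ l) (int p ^ j * u)"
    then obtain y where y: "[y\<^sup>2 = int p ^ j * u] (mod int p ^ l)"
      by (auto simp: QuadRes_def)
    then obtain s where "y\<^sup>2 = int p ^ j * u + int p ^ l * s"
      by (metis cong_iff_lin cong_sym)
    then have y2: "y\<^sup>2 = int p ^ j * (u + int p ^ (l - j) * s)"
      unfolding l(1) by (simp add: algebra_simps)
    have "int p dvd int p ^ (l - j)"
      using assms(4) by (intro dvd_power) auto
    then have nd: "\<not> int p dvd u + int p ^ (l - j) * s"
      using assms(3) by (simp add: dvd_add_left_iff)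
    then have "y \<noteq> 0" using y2 p by auto
    then obtain w where w: "y = int p ^ multiplicity (int p) y * w" "\<not> int p dvd w"
      using p by (metis multiplicity_decompose' not_prime_unit)
    have "multiplicity (int p) (y\<^sup>2) = j"
      unfolding y2 using nd p by (intro multiplicity_eqI) (auto)
    then have j: "j = 2 * multiplicity (int p) y"
      using p \<open>y \<noteq> 0\<close> by (simp add: prime_elem_multiplicity_power_distrib)
    have "y\<^sup>2 = int p ^ j * w\<^sup>2"
      using w(1) j by (metis power_mult power_mult_distrib mult.commute)
    then have "w\<^sup>2 = u + int p ^ (l - j) * s"
      using y2 p by auto
    then have "[w\<^sup>2 = u] (mod int p)"
      using \<open>int p dvd int p ^ (l - j)\<close> by (simp add: cong_iff_dvd_diff)
    then show "even j \<and> QuadRes (int p) u"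
      using j by (auto simp: QuadRes_def)
  }
  {
    assume *: "even j \<and> QuadRes (int p) u"
    then have "QuadRes (int p ^ (l - j)) u"
      using QuadRes_prime_power_iff[OF assms(1-3)] l(2) by metis
    then obtain y where "[y\<^sup>2 = u] (mod int p ^ (l - j))"
      by (auto simp: QuadRes_def)
    then have "[int p ^ j * y\<^sup>2 = int p ^ j * u] (mod int p ^ l)"
      unfolding l(1) by (rule cong_cmult_leftI)
    moreover obtain i where "j = 2 * i" using * by auto
    ultimately have "[(int p ^ i * y)\<^sup>2 = int p ^ j * u] (mod int p ^ l)"
      by (simp add: power_mult_distrib power_mult mult.commute flip: power_mult)
    then show "QuadRes (int p ^ l) (int p ^ j * u)"
      by (auto simp: QuadRes_def)
  }
qed

lemma bij_betw_squares_prime_power: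
  assumes "prime p" "2 < p"
  shows "bij_betw (\<lambda>(j, u). int p ^ j * u)
    (SIGMA j:{j. j < l \<and> even j}. {u \<in> {0..<int p ^ (l - j)}. \<not> int p dvd u \<and> QuadRes (int p) u})
    ({x \<in> {0..<int p ^ l}. QuadRes (int p ^ l) x} - {0})"
  unfolding bij_betw_def
proof
  have p: "prime (int p)" using assms by simp
  have pos: "int p > 0" using assms by simp
  let ?U = "\<lambda>j. {u \<in> {0..<int p ^ (l - j)}. \<not> int p dvd u \<and> QuadRes (int p) u}"
  let ?D = "SIGMA j:{j. j < l \<and> even j}. ?U j"
  show "inj_on (\<lambda>(j, u). int p ^ j * u) ?D"
  proof (rule inj_onI, safe)
    fix j u i v
    assume eq: "int p ^ j * u = int p ^ i * v" and nd: "\<not> int p dvd u" "\<not> int p dvd v"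
    have "multiplicity (int p) (int p ^ j * u) = j" "multiplicity (int p) (int p ^ i * v) = i"
      using nd p by (auto intro!: multiplicity_eqI)
    then show "j = i" using eq by simp
    then show "u = v" using eq pos by simp
  qed
  show "(\<lambda>(j, u). int p ^ j * u) ` ?D = {x \<in> {0..<int p ^ l}. QuadRes (int p ^ l) x} - {0}"
  proof (intro equalityI subsetI)
    fix x assume "x \<in> (\<lambda>(j, u). int p ^ j * u) ` ?D"
    then obtain j u where x: "x = int p ^ j * u" and j: "j < l" "even j" and u: "u \<in> ?U j"
      by auto
    have "int p ^ j * u < int p ^ j * int p ^ (l - j)"
      using u pos by (intro mult_strict_left_mono) auto
    also have "\<dots> = int p ^ l"
      using j by (simp flip: power_add)
    finally have "x < int p ^ l" using x by simp
    moreover have "x \<ge> 0" "x \<noteq> 0" using x u pos by auto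
    moreover have "QuadRes (int p ^ l) x"
      unfolding x using QuadRes_prime_power_mult_iff[OF assms _ j(1)] u j by simp
    ultimately show "x \<in> {x \<in> {0..<int p ^ l}. QuadRes (int p ^ l) x} - {0}"
      by simp
  next
    fix x assume x: "x \<in> {x \<in> {0..<int p ^ l}. QuadRes (int p ^ l) x} - {0}"
    then have "x \<noteq> 0" by simp
    then obtain j u where xu: "x = int p ^ j * u" "\<not> int p dvd u"
      using p by (metis multiplicity_decompose' not_prime_unit)
    have "0 < int p ^ j * u" unfolding xu(1)[symmetric] using x by auto
    then have u: "u > 0" using pos by (simp add: zero_less_mult_iff)
    have "int p ^ j * 1 \<le> int p ^ j * u"
      using u pos by (intro mult_left_mono) auto
    also have "\<dots> < int p ^ l" using x xu by simp
    finally have j: "j < l"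
      using assms by simp
    have "int p ^ j * u < int p ^ j * int p ^ (l - j)"
      using x xu j by (simp flip: power_add)
    then have "u < int p ^ (l - j)" using pos by simp
    moreover have "even j \<and> QuadRes (int p) u"
      using QuadRes_prime_power_mult_iff[OF assms xu(2) j] x xu(1) by simp
    ultimately have "(j, u) \<in> ?D" using j u xu(2) by simp
    then show "x \<in> (\<lambda>(j, u). int p ^ j * u) ` ?D"
      using xu(1) by (force intro!: image_eqI[of _ _ "(j, u)"])
  qed
qed

lemma Ramanujan_sum_residues:
  assumes "N > 0"
  shows "Ramanujan_sum N c = (\<Sum>u | u \<in> {0..<int N} \<and> coprime u (int N). e_mod N (c * u))"
proof -
  define f where "f u = (if coprime u (int N) then e_mod N (c * u) else 0)" for u
  have f: "f u = f v" if "[u = v] (mod int N)" for u v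
    using that assms cong_imp_coprime[OF that] cong_imp_coprime[OF cong_sym[OF that]]
    by (auto simp: f_def intro: e_mod_cong cong_scalar_left)
  have gcd_iff: "gcd j N = 1 \<longleftrightarrow> coprime (int j) (int N)" for j
    using coprime_iff_gcd_eq_1[of j N] by (simp only: coprime_int_iff)
  have "Ramanujan_sum N c = (\<Sum>j\<in>{1..N}. if gcd j N
      = 1 then e_fun (real j * real_of_int c / real N) else 0)"
    unfolding Ramanujan_sum_def by (subst sum.inter_filter[symmetric]) auto
  also have "\<dots> = (\<Sum>j = 1..N. f (int j))"
    unfolding gcd_iff by (rule sum.cong) (simp_all only: f_def
        e_mod_def of_int_mult of_int_of_nat_eq mult.commute)
  also have "\<dots> = (\<Sum>u\<in>{0..<int N}. f u)"
    by (rule sum_residues_atLeastAtMost[OF assms f])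
  also have "\<dots> = (\<Sum>u | u \<in> {0..<int N} \<and> coprime u (int N). e_mod N (c * u))"
    unfolding f_def by (rule sum.inter_filter[symmetric]) simp
  finally show ?thesis .
qed

definition local_term :: "nat \<Rightarrow> nat \<Rightarrow> nat \<Rightarrow> int \<Rightarrow> complex" where
  "local_term p l j x =
     Ramanujan_sum (p ^ (l - j)) x
     + eps p * of_int (Legendre (x div int p ^ (l - j - 1)) (int p))
       * rho p l j x * complex_of_real (real p powr (real l - real j - 1 / 2))"

lemma sum_unit_squares:
  assumes "prime p" "2 < p" "j < l"
  shows "(\<Sum>u | u \<in> {0..<int p ^ (l - j)} \<and> \<not> int p dvd u \<and> QuadRes (int p) u.
      e_mod (p ^ (l - j)) (c * u))
       = local_term p l j c / 2"
proof -
  define t where "t = l - j - 1"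
  have lj: "l - j = Suc t" using assms(3) by (simp add: t_def)
  have p: "prime (int p)" and pos: "p > 0" using assms by auto
  let ?R = "{0..<int (p ^ Suc t)}"
  let ?L = "\<lambda>u. complex_of_int (Legendre u (int p))"
  let ?f = "\<lambda>u. e_mod (p ^ Suc t) (c * u)"
  have cop: "coprime u (int (p ^ Suc t)) \<longleftrightarrow> \<not> int p dvd u" for u
    using p by (auto simp: coprime_commute[of u] prime_imp_coprime coprime_power_left_iff
        dest: not_coprimeI[of "int p" "int p" u])
  have "(\<Sum>u | u \<in> ?R \<and> \<not> int p dvd u \<and> QuadRes (int p) u. ?f u)
      = (\<Sum>u\<in>?R. if \<not> int p dvd u \<and> QuadRes (int p) u then ?f u else 0)"
    by (subst sum.inter_filter[symmetric]) auto
  also have "\<dots> = (\<Sum>u\<in>?R. ((if \<not> int p dvd u then ?f u else 0) + ?L u * ?f u) / 2)"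
    by (rule sum.cong) (auto simp: Legendre_def cong_0_iff)
  also have "\<dots> = ((\<Sum>u\<in>?R. if \<not> int p dvd u then ?f u else 0) + (\<Sum>u\<in>?R. ?L u * ?f u)) / 2"
    by (simp only: sum.distrib flip: sum_divide_distrib)
  also have "(\<Sum>u\<in>?R. if \<not> int p dvd u then ?f u else 0) = Ramanujan_sum (p ^ Suc t) c"
    using pos by (subst Ramanujan_sum_residues, simp, unfold cop, subst sum.inter_filter[symmetric]) auto
  also have "(\<Sum>u\<in>?R. ?L u * ?f u) = eps p * ?L (c div int p ^ t) * rho p l j c
      * complex_of_real (real p powr (real l - real j - 1 / 2))"
  proof -
    have "real l - real j - 1 / 2 = 1 / 2 + real t"
      using assms(3) by (simp add: t_def)
    then have pw: "real p powr (real l - real j - 1 / 2) = sqrt (real p) * real (p ^ t)"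
      using pos by (simp only: powr_add powr_half_sqrt powr_realpow of_nat_power)
    show ?thesis
    proof (cases "int p ^ t dvd c")
      case True
      then obtain d where d: "c = int p ^ t * d" by (elim dvdE)
      have div: "c div int p ^ t = d" using d pos by simp
      have "rho p l j c = (if int p dvd d then 0 else 1)"
      proof -
        have "gcd c (int p ^ (l - j)) = int p ^ t * gcd d (int p)"
          unfolding d lj power_Suc2 gcd_mult_left by simp
        also have "\<dots> = int p ^ (l - j - 1) \<longleftrightarrow> gcd d (int p) = 1"
          using pos by (simp add: t_def)
        also have "\<dots> \<longleftrightarrow> \<not> int p dvd d"
          using p by (metis coprime_iff_gcd_eq_1 coprime_commute prime_imp_coprime
              coprime_absorb_left not_prime_unit)
        finally show ?thesis by (simp add: rho_def)
      qed
      moreover have "?L d = 0" if "int p dvd d"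
        using that by (simp add: Legendre_def cong_0_iff)
      ultimately have "?L d * rho p l j c = ?L d" by auto
      then have *: "eps p * ?L d * rho p l j c = eps p * ?L d" by (simp add: mult.assoc)
      show ?thesis
        unfolding sum_Legendre_e_mod_prime_power[OF assms(1,2)] pw div * using True
        by (simp add: mult_ac)
    next
      case False
      then have "gcd c (int p ^ (l - j)) \<noteq> int p ^ (l - j - 1)"
        by (metis gcd_dvd1 t_def)
      then show ?thesis
        unfolding sum_Legendre_e_mod_prime_power[OF assms(1,2)] using False by (simp add: rho_def)
    qed
  qed
  finally show ?thesis
    unfolding local_term_def lj of_nat_power[symmetric] by simp
qed

lemma sum_squares_prime_power:
  assumes "prime p" "2 < p"
  shows "(\<Sum>x | x \<in> {0..<int (p ^ l)} \<and> QuadRes (int (p ^ l)) x. e_mod (p ^ l) (c * x)) =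
    1 + (\<Sum>j | j < l \<and> even j. local_term p l j c) / 2"
proof -
  have pos: "p > 0" using assms by simp
  let ?U = "\<lambda>j. {u \<in> {0..<int p ^ (l - j)}. \<not> int p dvd u \<and> QuadRes (int p) u}"
  let ?Q = "{x \<in> {0..<int p ^ l}. QuadRes (int p ^ l) x}"
  have zero: "0 \<in> ?Q"
    using pos by (auto simp: QuadRes_def intro: exI[of _ 0])
  have finQ: "finite ?Q" by (rule finite_subset[of _ "{0..<int p ^ l}"]) auto
  have finU: "finite (?U j)" for j by (rule finite_subset[of _ "{0..<int p ^ (l - j)}"]) auto
  have "(\<Sum>x\<in>?Q. e_mod (p ^ l) (c * x)) = 1 + (\<Sum>x\<in>?Q - {0}. e_mod (p ^ l) (c * x))"
    by (subst sum.remove[OF finQ zero]) simp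
  also have "(\<Sum>x\<in>?Q - {0}. e_mod (p ^ l) (c * x))
      = (\<Sum>(j, u)\<in>(SIGMA j:{j. j < l \<and> even j}. ?U j). e_mod (p ^ l) (c * (int p ^ j * u)))"
    using sum.reindex_bij_betw[OF bij_betw_squares_prime_power[OF assms, of l],
        of "\<lambda>x. e_mod (p ^ l) (c * x)"]
    by (simp add: case_prod_beta)
  also have "\<dots> = (\<Sum>j | j < l \<and> even j. \<Sum>u\<in>?U j. e_mod (p ^ l) (c * (int p ^ j * u)))"
    using finU by (subst sum.Sigma) auto
  also have "\<dots> = (\<Sum>j | j < l \<and> even j. local_term p l j c / 2)"
  proof (rule sum.cong)
    fix j assume "j \<in> {j. j < l \<and> even j}"
    then have j: "j < l" by simp
    then have pl: "p ^ l = p ^ j * p ^ (l - j)" by (simp flip: power_add)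
    have "e_mod (p ^ l) (c * (int p ^ j * u)) = e_mod (p ^ (l - j)) (c * u)" for u
      using e_mod_cancel_left[of "p ^ j" "p ^ (l - j)" "c * u"] pos unfolding pl
          by (simp add: mult_ac)
    then show "(\<Sum>u\<in>?U j. e_mod (p ^ l) (c * (int p ^ j * u))) = local_term p l j c / 2"
      using sum_unit_squares[OF assms j, of c] by simp
  qed simp
  finally show ?thesis
    by (simp add: sum_divide_distrib)
qed

lemma S_count_eq_exponential_sum:
  assumes "N > 0"
  shows "of_nat N * of_nat (S_count N k b a) =
    (\<Sum>m = 1..N. e_fun (- real_of_int b * real m / real N) *
      (\<Prod>i = 1..k. \<Sum>x | x \<in> {0..<int N} \<and> QuadRes (int N) x. e_mod N (a i * int m * x)))"
proof -
  let ?Q = "{x \<in> {0..<int N}. QuadRes (int N) x}"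
  let ?P = "{1..k} \<rightarrow>\<^sub>E ?Q"
  let ?s = "\<lambda>x. \<Sum>i = 1..k. a i * x i"
  have finQ: "finite ?Q" by (rule finite_subset[of _ "{0..<int N}"]) auto
  then have fin: "finite ?P" by (intro finite_PiE) auto
  have "{x \<in> {1..k} \<rightarrow>\<^sub>E {0..<int N}. (\<forall>i\<in>{1..k}. QuadRes (int N) (x i)) \<and> [?s x = b] (mod int N)}
      = {x \<in> ?P. [?s x = b] (mod int N)}"
    by (auto simp: PiE_def Pi_def)
  then have "of_nat (S_count N k b a) = (\<Sum>x | x \<in> ?P \<and> [?s x = b] (mod int N). 1 :: complex)"
    by (simp add: S_count_def)
  then have "of_nat (S_count N k b a) = (\<Sum>x\<in>?P. if [?s x = b] (mod int N) then 1 else 0 :: complex)"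
    by (simp only: sum.inter_filter[OF fin])
  then have "of_nat N * of_nat (S_count N k b a)
      = (\<Sum>x\<in>?P. if int N dvd ?s x - b then of_nat N else 0 :: complex)"
    by (simp add: sum_distrib_left cong_iff_dvd_diff if_distrib cong: if_cong)
  also have "\<dots> = (\<Sum>x\<in>?P. \<Sum>m = 1..N. e_mod N ((?s x - b) * int m))"
  proof (rule sum.cong[OF refl])
    fix x
    have "(\<Sum>m = 1..N. e_mod N ((?s x - b) * int m)) = (\<Sum>m\<in>{0..<int N}. e_mod N ((?s x - b) * m))"
      using assms by (rule sum_residues_atLeastAtMost)
          (auto intro: e_mod_cong cong_scalar_left assms)
    then show "(if int N dvd ?s x - b then of_nat N else 0) = (\<Sum>m
        = 1..N. e_mod N ((?s x - b) * int m))"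
      by (simp add: e_mod_orthogonality[OF assms])
  qed
  also have "\<dots> = (\<Sum>m = 1..N. \<Sum>x\<in>?P. e_mod N ((?s x - b) * int m))"
    by (rule sum.swap)
  also have "\<dots> = (\<Sum>m = 1..N. e_fun (- real_of_int b * real m / real N) *
      (\<Prod>i = 1..k. \<Sum>x\<in>?Q. e_mod N (a i * int m * x)))"
  proof (rule sum.cong[OF refl])
    fix m
    have "(\<Prod>i = 1..k. \<Sum>x\<in>?Q. e_mod N (a i * int m * x)) = (\<Sum>x\<in>?P. \<Prod>i
        = 1..k. e_mod N (a i * int m * x i))"
      using finQ by (intro prod_sum_PiE) auto
    also have "\<dots> = (\<Sum>x\<in>?P. e_mod N (?s x * int m))"
      unfolding e_mod_prod sum_distrib_right by (simp only: mult_ac)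
    finally have *: "(\<Prod>i = 1..k. \<Sum>x\<in>?Q. e_mod N (a i * int m * x))
        = (\<Sum>x\<in>?P. e_mod N (?s x * int m))" .
    have "e_fun (- real_of_int b * real m / real N) = e_mod N (- b * int m)"
      by (simp add: e_mod_def)
    then show "(\<Sum>x\<in>?P. e_mod N ((?s x - b) * int m)) = e_fun (- real_of_int b * real m / real N) *
      (\<Prod>i = 1..k. \<Sum>x\<in>?Q. e_mod N (a i * int m * x))"
      unfolding * sum_distrib_left by (simp add: algebra_simps flip: e_mod_add)
  qed
  finally show ?thesis .
qed

lemma S_count_prime_power:
  assumes "prime p" "2 < p" "l \<ge> 1"
  shows "of_nat (S_count (p ^ l) k b a) = 1 / of_nat (p ^ l) *
    ((\<Sum>m = 1..p ^ l. e_fun (- real_of_int b * real m / real (p ^ l)))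
       + (\<Sum>K | K \<subseteq> {1..k} \<and> K \<noteq> {}. 1 / 2 ^ card K * S_sub p l b a K))"
proof -
  have pos: "p ^ l > 0" using assms by simp
  let ?e = "\<lambda>m. e_fun (- real_of_int b * real m / real (p ^ l))"
  let ?t = "\<lambda>c. \<Sum>j | j < l \<and> even j. local_term p l j c"
  have idx: "{j. j \<in> {0..l - 1} \<and> [j = 0] (mod 2)} = {j. j < l \<and> even j}"
    using assms(3) by (auto simp: cong_0_iff)
  have S_sub: "S_sub p l b a K = (\<Sum>m = 1..p ^ l. ?e m * (\<Prod>i\<in>K. ?t (a i * int m)))" for K
    unfolding S_sub_def idx local_term_def ..
  have "of_nat (p ^ l) * of_nat (S_count (p ^ l) k b a)
      = (\<Sum>m = 1..p ^ l. ?e m * (\<Prod>i = 1..k. ?t (a i * int m) / 2 + 1))"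
    unfolding S_count_eq_exponential_sum[OF pos] sum_squares_prime_power[OF assms(1,2)]
    by (simp only: add.commute)
  also have "\<dots> = (\<Sum>m = 1..p ^ l. \<Sum>K\<in>Pow {1..k}. 1 / 2 ^ card K * (?e m * (\<Prod>i\<in>K. ?t (a i * int m))))"
    by (subst prod_add) (simp_all add: prod_dividef sum_distrib_left)
  also have "\<dots> = (\<Sum>K\<in>Pow {1..k}. 1 / 2 ^ card K * S_sub p l b a K)"
    unfolding S_sub sum_distrib_left by (rule sum.swap)
  also have "\<dots> = S_sub p l b a {} + (\<Sum>K\<in>Pow {1..k} - {{}}. 1 / 2 ^ card K * S_sub p l b a K)"
    by (subst sum.remove[of _ "{}"]) auto
  also have "Pow {1..k} - {{}} = {K. K \<subseteq> {1..k} \<and> K \<noteq> {}}"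
    by auto
  also have "S_sub p l b a {} = (\<Sum>m = 1..p ^ l. ?e m)"
    by (simp add: S_sub)
  finally show ?thesis
    using assms(1) by (simp add: field_simps prime_gt_0_nat)
qed

section \<open>Multiplicativity of the count\<close>

lemma QuadRes_mult_coprime_iff:
  assumes "coprime M N"
  shows "QuadRes (M * N) x \<longleftrightarrow> QuadRes M x \<and> QuadRes N x"
proof
  assume "QuadRes (M * N) x"
  then show "QuadRes M x \<and> QuadRes N x"
    unfolding QuadRes_def by (metis cong_modulus_mult mult.commute)
next
  assume "QuadRes M x \<and> QuadRes N x"
  then obtain y z where y: "[y\<^sup>2 = x] (mod M)" and z: "[z\<^sup>2 = x] (mod N)"
    by (auto simp: QuadRes_def)
  obtain w where w: "[w = y] (mod M)" "[w = z] (mod N)"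
    using binary_chinese_remainder_int[OF assms, of y z] by blast
  have "[w\<^sup>2 = x] (mod M)" "[w\<^sup>2 = x] (mod N)"
    using cong_pow[OF w(1), of 2] cong_pow[OF w(2), of 2] y z cong_trans by blast+
  then have "[w\<^sup>2 = x] (mod (M * N))"
    using assms by (rule coprime_cong_mult)
  then show "QuadRes (M * N) x" by (auto simp: QuadRes_def)
qed

lemma cong_mult_coprime_iff:
  fixes M N :: int
  assumes "coprime M N"
  shows "[x = y] (mod (M * N)) \<longleftrightarrow> [x = y] (mod M) \<and> [x = y] (mod N)"
  using coprime_cong_mult[OF _ _ assms, of x y] cong_modulus_mult[of x y M N]
    cong_modulus_mult[of x y N M, unfolded mult.commute[of N M]]
  by blast

definition square_sols :: "nat \<Rightarrow> nat \<Rightarrow> int \<Rightarrow> (nat \<Rightarrow> int) \<Rightarrow> (nat \<Rightarrow> int) set" where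
  "square_sols n k b a = {x \<in> {1..k} \<rightarrow>\<^sub>E {0..<int n}.
     (\<forall>i\<in>{1..k}. QuadRes (int n) (x i)) \<and> [(\<Sum>i = 1..k. a i * x i) = b] (mod int n)}"

lemma restrict_mod_in_square_sols_iff:
  assumes "M > 0"
  shows "(\<lambda>i\<in>{1..k}. x i mod int M) \<in> square_sols M k b a \<longleftrightarrow>
    (\<forall>i\<in>{1..k}. QuadRes (int M) (x i)) \<and> [(\<Sum>i = 1..k. a i * x i) = b] (mod int M)"
proof -
  have "QuadRes (int M) (x i mod int M) \<longleftrightarrow> QuadRes (int M) (x i)" for i
    by (rule QuadRes_cong) simp
  moreover have "[(\<Sum>i = 1..k. a i * (x i mod int M)) = (\<Sum>i = 1..k. a i * x i)] (mod int M)"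
    by (intro cong_sum cong_scalar_left) simp
  then have "[(\<Sum>i = 1..k. a i * (x i mod int M)) = b] (mod int M)
      \<longleftrightarrow> [(\<Sum>i = 1..k. a i * x i) = b] (mod int M)"
    by (auto simp: cong_def)
  ultimately show ?thesis
    using assms by (auto simp: square_sols_def)
qed

lemma S_count_mult:
  assumes "coprime M N" "M > 0" "N > 0"
  shows "S_count (M * N) k b a = S_count M k b a * S_count N k b a"
proof -
  have cop: "coprime (int M) (int N)" using assms by simp
  let ?r = "\<lambda>n x. \<lambda>i\<in>{1..k}. x i mod int n"
  let ?F = "\<lambda>x. (?r M x, ?r N x)"
  let ?c = "\<lambda>n x. (\<forall>i\<in>{1..k}. QuadRes (int n) (x i)) \<and> [(\<Sum>i = 1..k. a i * x i) = b] (mod int n)"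
  have c_iff: "?c (M * N) x \<longleftrightarrow> ?c M x \<and> ?c N x" for x
    using QuadRes_mult_coprime_iff[OF cop] cong_mult_coprime_iff[OF cop] by auto
  have "bij_betw ?F (square_sols (M * N) k b a) (square_sols M k b a \<times> square_sols N k b a)"
    unfolding bij_betw_def
  proof
    show "inj_on ?F (square_sols (M * N) k b a)"
    proof (rule inj_onI)
      fix x y assume x: "x \<in> square_sols (M * N) k b a" and y: "y \<in> square_sols (M * N) k b a"
          and eq: "?F x = ?F y"
      show "x = y"
      proof (rule PiE_ext)
        show "x \<in> {1..k} \<rightarrow>\<^sub>E {0..<int (M * N)}" "y \<in> {1..k} \<rightarrow>\<^sub>E {0..<int (M * N)}"
          using x y by (simp_all add: square_sols_def)
        fix i assume i: "i \<in> {1..k}"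
        have "[x i = y i] (mod int M)" "[x i = y i] (mod int N)"
          using eq i by (auto simp: cong_def fun_eq_iff restrict_def split: if_splits)
        then have "[x i = y i] (mod int (M * N))"
          using cong_mult_coprime_iff[OF cop] by simp
        moreover have "x i \<in> {0..<int (M * N)}" "y i \<in> {0..<int (M * N)}"
          using x y i by (auto simp: square_sols_def PiE_def Pi_def)
        ultimately show "x i = y i"
          by (simp add: cong_def)
      qed
    qed
    show "?F ` square_sols (M * N) k b a = square_sols M k b a \<times> square_sols N k b a"
    proof (intro equalityI subsetI)
      fix z assume "z \<in> ?F ` square_sols (M * N) k b a"
      then obtain x where z: "z = ?F x" and "x \<in> square_sols (M * N) k b a" by blast
      then have "?c (M * N) x" by (simp add: square_sols_def)
      then have "?c M x" "?c N x" unfolding c_iff by auto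
      then show "z \<in> square_sols M k b a \<times> square_sols N k b a"
        unfolding z mem_Times_iff fst_conv snd_conv restrict_mod_in_square_sols_iff[OF assms(2)]
          restrict_mod_in_square_sols_iff[OF assms(3)] by blast
    next
      fix z assume "z \<in> square_sols M k b a \<times> square_sols N k b a"
      then obtain y w where z: "z
          = (y, w)" and y: "y \<in> square_sols M k b a" and w: "w \<in> square_sols N k b a"
        by blast
      have "\<exists>x. [x = y i] (mod int M) \<and> [x = w i] (mod int N)" for i
        using binary_chinese_remainder_int[OF cop] by blast
      then obtain v where v: "[v i = y i] (mod int M)" "[v i = w i] (mod int N)" for i
        by metis
      have ry: "?r M v = y"
      proof
        fix i
        show "?r M v i = y i"
          using v(1)[of i] y by (cases "i \<in> {1..k}")
              (auto simp: square_sols_def cong_def PiE_def extensional_def Pi_def)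
      qed
      have rw: "?r N v = w"
      proof
        fix i
        show "?r N v i = w i"
          using v(2)[of i] w by (cases "i \<in> {1..k}")
              (auto simp: square_sols_def cong_def PiE_def extensional_def Pi_def)
      qed
      have "?c M v" "?c N v"
        using restrict_mod_in_square_sols_iff[OF assms(2), of v k b a]
            restrict_mod_in_square_sols_iff[OF assms(3), of v k b a]
          y w unfolding ry rw by simp_all
      then have "?c (M * N) v" unfolding c_iff by simp
      then have in_square_sols: "?r (M * N) v \<in> square_sols (M * N) k b a"
        using restrict_mod_in_square_sols_iff[of "M * N" v k b a] assms(2,3) by simp
      have "?r M (?r (M * N) v) = ?r M v" "?r N (?r (M * N) v) = ?r N v"
        by (auto simp: restrict_def fun_eq_iff mod_mod_cancel)
      then have "?F (?r (M * N) v) = z"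
        unfolding ry rw z by simp
      then show "z \<in> ?F ` square_sols (M * N) k b a"
        using in_square_sols by blast
    qed
  qed
  then have "card (square_sols (M * N) k b a) = card (square_sols M k b a \<times> square_sols N k b a)"
    by (rule bij_betw_same_card)
  then show ?thesis
    by (simp add: S_count_def square_sols_def card_cartesian_product)
qed

lemma S_count_1: "S_count 1 k b a = 1"
proof -
  have "{0..<int 1} = {0}" by auto
  then have "{x \<in> {1..k} \<rightarrow>\<^sub>E {0..<int 1}. (\<forall>i\<in>{1..k}. QuadRes (int 1) (x i)) \<and>
      [(\<Sum>i = 1..k. a i * x i) = b] (mod int 1)} = {1..k} \<rightarrow>\<^sub>E {0::int}"
    by (simp add: QuadRes_def)
  then show ?thesis
    by (simp add: S_count_def card_PiE)
qed

lemma S_count_prod: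
  assumes "finite A" "\<And>q. q \<in> A \<Longrightarrow> f q > 0"
    and "\<And>q r. q \<in> A \<Longrightarrow> r \<in> A \<Longrightarrow> q \<noteq> r \<Longrightarrow> coprime (f q) (f r)"
  shows "S_count (\<Prod>q\<in>A. f q) k b a = (\<Prod>q\<in>A. S_count (f q) k b a)"
  using assms
proof (induction A)
  case empty
  then show ?case using S_count_1 by simp
next
  case (insert q A)
  have "coprime (f q) (\<Prod>q\<in>A. f q)"
    using insert.hyps insert.prems(2) by (intro prod_coprime_right) auto
  moreover have "f q > 0" "(\<Prod>q\<in>A. f q) > 0"
    using insert.prems(1) by (auto intro!: prod_pos)
  ultimately show ?case
    using insert by (simp add: S_count_mult)
qed

theorem theorem1:
  fixes n r k :: nat and p l :: "nat \<Rightarrow> nat" and a :: "nat \<Rightarrow> int" and b :: int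
  assumes "odd n"
    and "n = (\<Prod>q = 1..r. p q ^ l q)"
    and "\<And>q. q \<in> {1..r} \<Longrightarrow> prime (p q)"
    and "inj_on p {1..r}"
    and "\<And>q. q \<in> {1..r} \<Longrightarrow> l q \<ge> 1"
    and "k \<ge> 1"
  shows "complex_of_nat (S_count n k b a) =
    1 / complex_of_nat n *
    (\<Prod>q = 1..r.
       (\<Sum>m = 1..p q ^ l q. e_fun (- real_of_int b * real m / real (p q ^ l q)))
       + (\<Sum>K | K \<subseteq> {1..k} \<and> K \<noteq> {}. 1 / 2 ^ card K * S_sub (p q) (l q) b a K))"
proof -
  have p2: "2 < p q" if q: "q \<in> {1..r}" for q
  proof -
    have "p q dvd p q ^ l q"
      using assms(5)[OF q] by (intro dvd_power) auto
    also have "\<dots> dvd n"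
      unfolding assms(2) using q by (intro dvd_prodI) auto
    finally have "p q \<noteq> 2" using assms(1) by auto
    then show ?thesis
      using prime_ge_2_nat[OF assms(3)[OF q]] by linarith
  qed
  have "S_count n k b a = (\<Prod>q = 1..r. S_count (p q ^ l q) k b a)"
    unfolding assms(2)
  proof (rule S_count_prod)
    fix q s assume qs: "q \<in> {1..r}" "s \<in> {1..r}" "q \<noteq> s"
    then have "p q \<noteq> p s" using assms(4) by (auto dest: inj_onD)
    then show "coprime (p q ^ l q) (p s ^ l s)"
      using assms(3) qs by (intro coprime_power_left_iff[THEN iffD2] disjI1
          coprime_power_right_iff[THEN iffD2]) (simp add: primes_coprime)
  qed (simp_all add: assms(3) prime_gt_0_nat)
  then have "complex_of_nat (S_count n k b a) = (\<Prod>q = 1..r. of_nat (S_count (p q ^ l q) k b a))"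
    by simp
  also have "\<dots> = (\<Prod>q = 1..r. 1 / of_nat (p q ^ l q) *
      ((\<Sum>m = 1..p q ^ l q. e_fun (- real_of_int b * real m / real (p q ^ l q)))
       + (\<Sum>K | K \<subseteq> {1..k} \<and> K \<noteq> {}. 1 / 2 ^ card K * S_sub (p q) (l q) b a K)))"
    by (intro prod.cong refl S_count_prime_power assms(3,5) p2)
  also have "\<dots> = 1 / of_nat n * (\<Prod>q = 1..r.
       (\<Sum>m = 1..p q ^ l q. e_fun (- real_of_int b * real m / real (p q ^ l q)))
       + (\<Sum>K | K \<subseteq> {1..k} \<and> K \<noteq> {}. 1 / 2 ^ card K * S_sub (p q) (l q) b a K))"
    unfolding prod.distrib assms(2) by (simp add: prod_dividef)
  finally show ?thesis .
qed

end
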